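(* Assume that the coherency condition holds: for any $T\in(0,\infty)$, $$\lim_{n\to\infty}\mathsf{E}\sup_{\|\mathbf t\|\le T}\big|h_{n,N_n}(\mathbf t)-h(\mathbf t)\big|=0 .$$ If there exist a random variable $U$ and an $m$-dimensional random vector $\mathbf V$ such that, with $\mathbf W=(U,\mathbf V^\top)^\top$, $$\mathbf W_n\Longrightarrow \mathbf W\qquad(n\to\infty),$$ then $$\mathbf Z_n\Longrightarrow \mathbf Z\stackrel{d}{=}U\cdot\mathbf Y+\mathbf V\qquad(n\to\infty),$$ where the random vectors $\mathbf Y$ and $\mathbf W=(U,\mathbf V^\top)^\top$ are independent.
   Context: Fix $m\in\mathbb N=\{1,2,\dots\}$. All random elements are defined on one probability space $(\Omega,\mathfrak F,\mathsf P)$. $\langle\cdot,\cdot\rangle$ and $\|\cdot\|$ are the Euclidean scalar product and norm in $\mathbb R^m$; $\stackrel{d}{=}$ is equality in distribution and $\Longrightarrow$ is convergence in distribution. Let $\{\mathbf S_{n,k}\}_{n,k\in\mathbb N}$ be a double array of $\mathbb R^m$-valued random vectors (no independence within rows is assumed). Let $\mathbf a_{n,k}\in\mathbb R^m$ be non-random vectors and $b_{n,k}>0$ non-random real numbers, $n,k\in\mathbb N$. Put $\mathbf Y_{n,k}=b_{n,k}^{-1}(\mathbf S_{n,k}-\mathbf a_{n,k})$ and let $h_{n,k}$ be the characteristic function of $\mathbf Y_{n,k}$. Let $\{N_n\}_{n\in\mathbb N}$ be random variables with values in $\mathbb N$ such that for all $n,k\in\mathbb N$ the random variable $N_n$ and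 the random vector $\mathbf S_{n,k}$ are independent. Let $\mathbf c_n\in\mathbb R^m$ and $d_n>0$, $n\in\mathbb N$, be non-random. Put $$\mathbf Z_n=d_n^{-1}(\mathbf S_{n,N_n}-\mathbf c_n),\quad U_n=d_n^{-1}b_{n,N_n},\quad \mathbf V_n=d_n^{-1}(\mathbf a_{n,N_n}-\mathbf c_n),\quad \mathbf W_n=(U_n,\mathbf V_n^\top)^\top\in\mathbb R^{m+1}.$$ $\mathbf Y$ is an $\mathbb R^m$-valued random vector with characteristic function $h$. In the coherency condition, $h_{n,N_n}(\mathbf t)$ denotes the random variable obtained by substituting $k=N_n$ into $h_{n,k}(\mathbf t)$. *)

theory Defs
  imports "HOL-Probability.Probability"
begin

definition char_vec :: "'a::euclidean_space measure \<Rightarrow> 'a \<Rightarrow> complex" where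
  "char_vec \<mu> t = (CLINT x|\<mu>. iexp (t \<bullet> x))"

(* indep_var forces both random variables to have the same value type; this is its
   heterogeneous counterpart. *)
definition indep_rv ::
  "'a measure \<Rightarrow> 'b measure \<Rightarrow> ('a \<Rightarrow> 'b) \<Rightarrow> 'c measure \<Rightarrow> ('a \<Rightarrow> 'c) \<Rightarrow> bool" where
  "indep_rv M S X T Y \<longleftrightarrow>
     X \<in> measurable M S \<and> Y \<in> measurable M T \<and>
     prob_space.indep_set M
       {X -` A \<inter> space M | A. A \<in> sets S} {Y -` B \<inter> space M | B. B \<in> sets T}"

(* The library's weak_conv_m is restricted to measures on the real line. The limit may live
   on a probability space L different from M. *)
definition conv_in_distr ::
  "'a measure \<Rightarrow> (nat \<Rightarrow> 'a \<Rightarrow> 'c::topological_space) \<Rightarrow> 'b measure \<Rightarrow> ('b \<Rightarrow> 'c) \<Rightarrow> bool" where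
  "conv_in_distr M X L X\<^sub>0 \<longleftrightarrow>
     (\<forall>f :: 'c \<Rightarrow> real. continuous_on UNIV f \<longrightarrow> bounded (range f) \<longrightarrow>
        (\<lambda>n. \<integral>\<omega>. f (X n \<omega>) \<partial>M) \<longlonglongrightarrow> (\<integral>\<omega>. f (X\<^sub>0 \<omega>) \<partial>L))"

lemma char_vec_real: "char_vec \<mu> t = char \<mu> t" for \<mu> :: "real measure"
  by (simp add: char_vec_def char_def)

lemma (in prob_space) indep_rv_iff_indep_var: "indep_rv M S X T Y \<longleftrightarrow> indep_var S X T Y"
proof
  assume I: "indep_rv M S X T Y"
  have "Int_stable {Z -` A \<inter> space M | A. A \<in> sets R}" for Z :: "'a \<Rightarrow> 'b" and R
    unfolding Int_stable_def
  proof clarify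
    fix A B assume "A \<in> sets R" "B \<in> sets R"
    then show "\<exists>C. (Z -` A \<inter> space M) \<inter> (Z -` B \<inter> space M) = Z -` C \<inter> space M \<and> C \<in> sets R"
      by (intro exI[of _ "A \<inter> B"]) auto
  qed
  with I show "indep_var S X T Y"
    unfolding indep_rv_def indep_var_eq by (blast intro: indep_set_sigma_sets)
next
  assume "indep_var S X T Y"
  then show "indep_rv M S X T Y"
    unfolding indep_rv_def indep_var_eq indep_sets2_eq
    by (auto intro: sigma_sets.Basic)
qed

end

theory Submission
  imports Defs
begin

text \<open>
  Condition on the random index. Since \<open>N n\<close> is independent of each \<open>S n k\<close>, the characteristic function
  of \<open>Zs n\<close> at \<open>t\<close> is the expectation of \<open>hnk n (N n) (Us n *\<^sub>R t) * iexp (t \<bullet> Vs n)\<close>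
  (lemma \<open>expectation_random_index\<close>). The coherency condition permits replacing \<open>hnk n (N n)\<close> by \<open>h\<close>: the
  convergent, hence tight, variables \<open>Us n\<close> keep the argument \<open>Us n *\<^sub>R t\<close> in a fixed ball with probability
  close to 1, and on that ball the difference is small in mean (lemma
  \<open>random_char_substitution_error\<close>). After the replacement the integrand is a bounded continuous function
  of \<open>(Us n, Vs n)\<close>, so its expectation converges to that of \<open>h (U *\<^sub>R t) * iexp (t \<bullet> V)\<close>, which by
  independence of \<open>Y\<close> and \<open>(U, V)\<close> is the characteristic function of \<open>U *\<^sub>R Y + V\<close> (lemma
  \<open>char_vec_affine_indep\<close>).

  What remains is Levy's continuity theorem for random vectors (theorem \<open>levy_continuity_euclidean\<close>). Its
  proof takes tightness from the one-dimensional theorem applied to the coordinates. Then it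
  approximates a bounded continuous function on a large ball by a trigonometric polynomial that
  remains bounded on the whole space (lemma \<open>trig_poly_approximation\<close>). Such a polynomial arises from
  the Stone-Weierstrass theorem after the coordinatewise substitution \<open>y = sin (s x)\<close>.

  The hypotheses govern the indices \<open>n \<ge> 1\<close>, so the argument runs along \<open>Suc n\<close>.
\<close>

section \<open>Characteristic functions of random vectors\<close>

lemma char_vec_distr:
  fixes X :: "'a \<Rightarrow> 'b::euclidean_space"
  assumes [measurable]: "X \<in> borel_measurable M"
  shows "char_vec (distr M borel X) t = (CLINT \<omega>|M. iexp (t \<bullet> X \<omega>))"
  unfolding char_vec_def by (rule integral_distr) auto

lemma (in prob_space) integrable_iexp_inner:
  fixes X :: "'a \<Rightarrow> 'b::euclidean_space"
  assumes [measurable]: "X \<in> borel_measurable M"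
  shows "integrable M (\<lambda>\<omega>. iexp (t \<bullet> X \<omega>))"
  by (rule integrable_const_bound[where B=1]) auto

lemma (in prob_space) cmod_integral_le:
  fixes f :: "'a \<Rightarrow> complex"
  assumes "\<And>\<omega>. \<omega> \<in> space M \<Longrightarrow> cmod (f \<omega>) \<le> B" and "0 \<le> B"
  shows "cmod (CLINT \<omega>|M. f \<omega>) \<le> B"
proof (cases "integrable M f")
  case True
  have "cmod (CLINT \<omega>|M. f \<omega>) \<le> (\<integral>\<omega>. cmod (f \<omega>) \<partial>M)"
    by (rule integral_norm_bound)
  also have "\<dots> \<le> (\<integral>\<omega>. B \<partial>M)"
    using True assms by (intro integral_mono) auto
  finally show ?thesis by (simp add: prob_space)
qed (use assms in \<open>simp add: not_integrable_integral_eq\<close>)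

lemma cmod_char_vec_distr_le_1:
  fixes X :: "'a \<Rightarrow> 'b::euclidean_space"
  assumes "prob_space M" "X \<in> borel_measurable M"
  shows "cmod (char_vec (distr M borel X) t) \<le> 1"
  unfolding char_vec_distr[OF assms(2)]
  by (rule prob_space.cmod_integral_le[OF assms(1)]) auto

lemma continuous_char_vec_distr:
  fixes X :: "'a \<Rightarrow> 'b::euclidean_space"
  assumes "prob_space M" and [measurable]: "X \<in> borel_measurable M"
  shows "continuous_on UNIV (char_vec (distr M borel X))"
proof -
  interpret prob_space M by fact
  have "isCont (\<lambda>t. CLINT \<omega>|M. iexp (t \<bullet> X \<omega>)) t" for t
    unfolding continuous_at_sequentially
  proof safe
    fix s assume s: "s \<longlonglongrightarrow> t"
    show "((\<lambda>t. CLINT \<omega>|M. iexp (t \<bullet> X \<omega>)) \<circ> s) \<longlonglongrightarrow> (CLINT \<omega>|M. iexp (t \<bullet> X \<omega>))"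
      unfolding comp_def
      by (rule integral_dominated_convergence[where w="\<lambda>_. 1"]) (auto intro!: tendsto_intros s)
  qed
  then show ?thesis
    by (auto simp: char_vec_distr continuous_on_eq_continuous_at)
qed

section \<open>Convergence in distribution and tightness\<close>

lemma conv_in_distr_Suc_iff:
  "conv_in_distr M (\<lambda>n. X (Suc n)) L X\<^sub>0 \<longleftrightarrow> conv_in_distr M X L X\<^sub>0"
proof -
  have "(\<lambda>n. \<integral>\<omega>. f (X (Suc n) \<omega>) \<partial>M) \<longlonglongrightarrow> l \<longleftrightarrow> (\<lambda>n. \<integral>\<omega>. f (X n \<omega>) \<partial>M) \<longlonglongrightarrow> l"
    for f :: "'b \<Rightarrow> real" and l
    by (rule filterlim_sequentially_Suc)
  then show ?thesis unfolding conv_in_distr_def by simp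
qed

lemma conv_in_distr_continuous_image:
  assumes "conv_in_distr M X L X\<^sub>0" and g: "continuous_on UNIV g"
  shows "conv_in_distr M (\<lambda>n \<omega>. g (X n \<omega>)) L (\<lambda>\<omega>. g (X\<^sub>0 \<omega>))"
  unfolding conv_in_distr_def
proof (intro allI impI)
  fix f :: "'d \<Rightarrow> real" assume f: "continuous_on UNIV f" "bounded (range f)"
  have "continuous_on UNIV (\<lambda>x. f (g x))"
    by (rule continuous_on_compose2[OF f(1) g]) auto
  moreover have "bounded (range (\<lambda>x. f (g x)))"
    by (rule bounded_subset[OF f(2)]) auto
  ultimately show "(\<lambda>n. \<integral>\<omega>. f (g (X n \<omega>)) \<partial>M) \<longlonglongrightarrow> (\<integral>\<omega>. f (g (X\<^sub>0 \<omega>)) \<partial>L)"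
    using assms(1) unfolding conv_in_distr_def by blast
qed

lemma conv_in_distr_complex:
  fixes f :: "'c::{second_countable_topology} \<Rightarrow> complex"
  assumes conv: "conv_in_distr M X L X\<^sub>0" and "prob_space M" "prob_space L"
    and X[measurable]: "\<And>n. X n \<in> borel_measurable M" "X\<^sub>0 \<in> borel_measurable L"
    and f: "continuous_on UNIV f" and B: "\<And>x. cmod (f x) \<le> B"
  shows "(\<lambda>n. CLINT \<omega>|M. f (X n \<omega>)) \<longlonglongrightarrow> (CLINT \<omega>|L. f (X\<^sub>0 \<omega>))"
proof -
  interpret M: prob_space M by fact
  interpret L: prob_space L by fact
  have [measurable]: "f \<in> borel_measurable borel"
    using f by (rule borel_measurable_continuous_onI)
  have int: "integrable M (\<lambda>\<omega>. f (X n \<omega>))" "integrable L (\<lambda>\<omega>. f (X\<^sub>0 \<omega>))" for n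
    by (auto intro!: M.integrable_const_bound[where B=B] L.integrable_const_bound[where B=B] B)
  have "bounded (range (\<lambda>x. Re (f x)))" "bounded (range (\<lambda>x. Im (f x)))"
    by (auto intro!: boundedI[where B=B] order_trans[OF abs_Re_le_cmod B] order_trans[OF abs_Im_le_cmod B])
  then have "(\<lambda>n. \<integral>\<omega>. Re (f (X n \<omega>)) \<partial>M) \<longlonglongrightarrow> (\<integral>\<omega>. Re (f (X\<^sub>0 \<omega>)) \<partial>L)"
    "(\<lambda>n. \<integral>\<omega>. Im (f (X n \<omega>)) \<partial>M) \<longlonglongrightarrow> (\<integral>\<omega>. Im (f (X\<^sub>0 \<omega>)) \<partial>L)"
    using conv f unfolding conv_in_distr_def by (auto intro!: continuous_intros)
  then show ?thesis
    unfolding tendsto_complex_iff using int by simp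
qed

text \<open>
  The limit puts little mass outside some interval \<open>[-k, k]\<close>. An indicator cannot be integrated
  against the convergence, so the ramp \<open>\<psi> k\<close>, which vanishes on \<open>[-k, k]\<close> and equals 1 outside
  \<open>[-k-1, k+1]\<close>, carries the smallness from the limit to the sequence.
\<close>

lemma conv_in_distr_tight_real:
  fixes X :: "nat \<Rightarrow> 'a \<Rightarrow> real" and X\<^sub>0 :: "'b \<Rightarrow> real"
  assumes conv: "conv_in_distr M X L X\<^sub>0" and "prob_space M" "prob_space L"
    and X[measurable]: "\<And>n. X n \<in> borel_measurable M" "X\<^sub>0 \<in> borel_measurable L"
    and "0 < \<epsilon>"
  obtains K where "\<forall>\<^sub>F n in sequentially. measure M {\<omega> \<in> space M. K < \<bar>X n \<omega>\<bar>} < \<epsilon>"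
proof -
  interpret M: prob_space M by fact
  interpret L: prob_space L by fact
  define \<psi> :: "nat \<Rightarrow> real \<Rightarrow> real" where "\<psi> k x = min 1 (max 0 (\<bar>x\<bar> - real k))" for k x
  have \<psi>_cont: "continuous_on UNIV (\<psi> k)" for k
    unfolding \<psi>_def by (intro continuous_intros)
  then have [measurable]: "\<psi> k \<in> borel_measurable borel" for k
    by (rule borel_measurable_continuous_onI)
  have \<psi>_bd: "\<bar>\<psi> k x\<bar> \<le> 1" for k x
    by (auto simp: \<psi>_def)
  \<comment> \<open>For fixed argument the ramp eventually vanishes, and dominated convergence applies.\<close>
  have "(\<lambda>k. \<psi> k x) \<longlonglongrightarrow> 0" for x
  proof (rule tendsto_eventually)
    show "\<forall>\<^sub>F k in sequentially. \<psi> k x = 0"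
      using eventually_ge_at_top[of "nat \<lceil>\<bar>x\<bar>\<rceil>"]
    proof eventually_elim
      case (elim k)
      then have "\<bar>x\<bar> \<le> real k" by linarith
      then show ?case by (simp add: \<psi>_def)
    qed
  qed
  then have "(\<lambda>k. \<integral>\<omega>. \<psi> k (X\<^sub>0 \<omega>) \<partial>L) \<longlonglongrightarrow> (\<integral>\<omega>. 0 \<partial>L)"
    by (intro integral_dominated_convergence[where w="\<lambda>_. 1"]) (auto simp: \<psi>_bd)
  then have "\<forall>\<^sub>F k in sequentially. (\<integral>\<omega>. \<psi> k (X\<^sub>0 \<omega>) \<partial>L) < \<epsilon>"
    using \<open>0 < \<epsilon>\<close> by (auto dest: order_tendstoD)
  then obtain k where k: "(\<integral>\<omega>. \<psi> k (X\<^sub>0 \<omega>) \<partial>L) < \<epsilon>"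
    by (auto simp: eventually_sequentially)
  have "(\<lambda>n. \<integral>\<omega>. \<psi> k (X n \<omega>) \<partial>M) \<longlonglongrightarrow> (\<integral>\<omega>. \<psi> k (X\<^sub>0 \<omega>) \<partial>L)"
    using conv \<psi>_cont[of k] boundedI[of "range (\<psi> k)" 1] \<psi>_bd unfolding conv_in_distr_def by auto
  then have "\<forall>\<^sub>F n in sequentially. (\<integral>\<omega>. \<psi> k (X n \<omega>) \<partial>M) < \<epsilon>"
    using k by (rule order_tendstoD)
  then have "\<forall>\<^sub>F n in sequentially. measure M {\<omega> \<in> space M. real k + 1 < \<bar>X n \<omega>\<bar>} < \<epsilon>"
  proof eventually_elim
    case (elim n)
    have "measure M {\<omega> \<in> space M. real k + 1 < \<bar>X n \<omega>\<bar>}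
        = (\<integral>\<omega>. indicator {\<omega> \<in> space M. real k + 1 < \<bar>X n \<omega>\<bar>} \<omega> \<partial>M)"
      by simp
    also have "\<dots> \<le> (\<integral>\<omega>. \<psi> k (X n \<omega>) \<partial>M)"
    proof (rule integral_mono)
      show "integrable M (\<lambda>\<omega>. \<psi> k (X n \<omega>))"
        by (rule M.integrable_const_bound[where B=1]) (auto simp: \<psi>_bd)
      show "indicator {\<omega> \<in> space M. real k + 1 < \<bar>X n \<omega>\<bar>} \<omega> \<le> \<psi> k (X n \<omega>)" for \<omega>
        by (auto simp: indicator_def \<psi>_def)
    qed (auto simp: integrable_indicator_iff M.emeasure_eq_measure)
    finally show ?case using elim by simp
  qed
  then show thesis by (rule that)
qed

text \<open>
  A norm exceeding \<open>\<Sum>b. K b\<close> forces some coordinate \<open>b\<close> beyond its own bound \<open>K b\<close>, because the norm is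
  at most the sum of the absolute coordinates. This is how one-dimensional tightness yields tightness
  of vectors.
\<close>

lemma tight_coordinates:
  fixes X :: "nat \<Rightarrow> 'a \<Rightarrow> 'c::euclidean_space"
  assumes "prob_space M" and [measurable]: "\<And>n. X n \<in> borel_measurable M" and "0 < \<epsilon>"
    and coord: "\<And>b \<delta>. b \<in> Basis \<Longrightarrow> 0 < \<delta> \<Longrightarrow>
      \<exists>K. \<forall>\<^sub>F n in sequentially. measure M {\<omega> \<in> space M. K < \<bar>X n \<omega> \<bullet> b\<bar>} < \<delta>"
  obtains K where "\<forall>\<^sub>F n in sequentially. measure M {\<omega> \<in> space M. K < norm (X n \<omega>)} < \<epsilon>"
proof -
  interpret prob_space M by fact
  have "0 < \<epsilon> / DIM('c)" using \<open>0 < \<epsilon>\<close> by simp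
  then have "\<forall>b\<in>Basis. \<exists>K. \<forall>\<^sub>F n in sequentially. measure M {\<omega> \<in> space M. K < \<bar>X n \<omega> \<bullet> b\<bar>} < \<epsilon> / DIM('c)"
    using coord by blast
  from bchoice[OF this] obtain K where "\<forall>b\<in>Basis.
      \<forall>\<^sub>F n in sequentially. measure M {\<omega> \<in> space M. K b < \<bar>X n \<omega> \<bullet> b\<bar>} < \<epsilon> / DIM('c)"
    by blast
  then have "\<forall>\<^sub>F n in sequentially. \<forall>b\<in>Basis. measure M {\<omega> \<in> space M. K b < \<bar>X n \<omega> \<bullet> b\<bar>} < \<epsilon> / DIM('c)"
    by (intro eventually_ball_finite) auto
  then have "\<forall>\<^sub>F n in sequentially. measure M {\<omega> \<in> space M. (\<Sum>b\<in>Basis. K b) < norm (X n \<omega>)} < \<epsilon>"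
  proof eventually_elim
    case (elim n)
    have "measure M {\<omega> \<in> space M. (\<Sum>b\<in>Basis. K b) < norm (X n \<omega>)}
      \<le> measure M (\<Union>b\<in>Basis. {\<omega> \<in> space M. K b < \<bar>X n \<omega> \<bullet> b\<bar>})"
    proof (rule finite_measure_mono)
      show "{\<omega> \<in> space M. (\<Sum>b\<in>Basis. K b) < norm (X n \<omega>)}
          \<subseteq> (\<Union>b\<in>Basis. {\<omega> \<in> space M. K b < \<bar>X n \<omega> \<bullet> b\<bar>})"
      proof (safe, rule ccontr)
        fix \<omega> assume *: "\<omega> \<in> space M" "(\<Sum>b\<in>Basis. K b) < norm (X n \<omega>)"
          "\<omega> \<notin> (\<Union>b\<in>Basis. {\<omega> \<in> space M. K b < \<bar>X n \<omega> \<bullet> b\<bar>})"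
        then have "(\<Sum>b\<in>Basis. \<bar>X n \<omega> \<bullet> b\<bar>) \<le> (\<Sum>b\<in>Basis. K b)"
          by (intro sum_mono) force
        with norm_le_l1[of "X n \<omega>"] *(2) show False by linarith
      qed
    qed auto
    also have "\<dots> \<le> (\<Sum>b\<in>Basis. measure M {\<omega> \<in> space M. K b < \<bar>X n \<omega> \<bullet> b\<bar>})"
      by (rule finite_measure_subadditive_finite) auto
    also have "\<dots> < (\<Sum>b\<in>(Basis::'c set). \<epsilon> / DIM('c))"
      using elim by (intro sum_strict_mono) auto
    finally show ?case by simp
  qed
  then show thesis by (rule that)
qed

section \<open>Approximation by trigonometric polynomials\<close>

text \<open>
  Pointwise convergence of characteristic functions is precisely convergence of the integrals of the
  monomials below, hence of all their linear combinations.
\<close>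

inductive trig_poly :: "('a::euclidean_space \<Rightarrow> complex) \<Rightarrow> bool" where
  monom: "trig_poly (\<lambda>x. c * iexp (t \<bullet> x))"
| add: "trig_poly f \<Longrightarrow> trig_poly g \<Longrightarrow> trig_poly (\<lambda>x. f x + g x)"

lemma trig_poly_const: "trig_poly (\<lambda>x. c)"
  using trig_poly.monom[of c 0] by simp

lemma trig_poly_mult_monom:
  assumes "trig_poly g"
  shows "trig_poly (\<lambda>x. c * iexp (t \<bullet> x) * g x)"
  using assms
proof induction
  case (monom c' t')
  have "(\<lambda>x. c * iexp (t \<bullet> x) * (c' * iexp (t' \<bullet> x))) = (\<lambda>x. (c * c') * iexp ((t + t') \<bullet> x))"
    by (simp add: fun_eq_iff inner_add_left exp_add algebra_simps)
  then show ?case by (simp only: trig_poly.monom)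
next
  case (add f g)
  from trig_poly.add[OF add.IH] show ?case by (simp add: algebra_simps)
qed

lemma trig_poly_mult:
  assumes "trig_poly f" "trig_poly g"
  shows "trig_poly (\<lambda>x. f x * g x)"
  using assms
proof induction
  case (monom c t)
  then show ?case by (rule trig_poly_mult_monom)
next
  case (add f1 f2)
  then have "trig_poly (\<lambda>x. f1 x * g x + f2 x * g x)" by (intro trig_poly.add) auto
  then show ?case by (simp add: algebra_simps)
qed

lemma trig_poly_sum:
  assumes "\<And>i. i \<in> I \<Longrightarrow> trig_poly (f i)"
  shows "trig_poly (\<lambda>x. \<Sum>i\<in>I. f i x)"
  using assms
  by (induction I rule: infinite_finite_induct) (auto intro: trig_poly.add trig_poly_const)

lemma trig_poly_sin_inner: "trig_poly (\<lambda>x. complex_of_real (sin (t \<bullet> x)))"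
proof -
  have "(\<lambda>x. complex_of_real (sin (t \<bullet> x)))
      = (\<lambda>x. (1 / (2 * \<i>)) * iexp (t \<bullet> x) + (- 1 / (2 * \<i>)) * iexp ((- t) \<bullet> x))"
    by (simp add: fun_eq_iff sin_of_real[symmetric] sin_exp_eq field_simps)
  then show ?thesis by (simp only:) (intro trig_poly.add trig_poly.monom)
qed

text \<open>
  The substitution \<open>x \<mapsto> sin (s x)\<close> in each coordinate maps the whole space into the cube \<open>[-1, 1]\<^sup>d\<close>
  and, for small \<open>s\<close>, is inverted by \<open>arcsin\<close> on a prescribed ball. Polynomials in the new
  variable are trigonometric polynomials in the old one.
\<close>

definition sin_vec :: "real \<Rightarrow> 'a::euclidean_space \<Rightarrow> 'a" where
  "sin_vec s x = (\<Sum>b\<in>Basis. sin (s * (x \<bullet> b)) *\<^sub>R b)"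

lemma sin_vec_inner: "b \<in> Basis \<Longrightarrow> sin_vec s x \<bullet> b = sin (s * (x \<bullet> b))"
  unfolding sin_vec_def by simp

lemma trig_poly_real_polynomial_sin_vec:
  fixes p :: "'a::euclidean_space \<Rightarrow> real"
  assumes "real_polynomial_function p"
  shows "trig_poly (\<lambda>x. complex_of_real (p (sin_vec s x)))"
  using assms
proof induction
  case (linear f)
  interpret bounded_linear f by fact
  have "trig_poly (\<lambda>x. \<Sum>b\<in>Basis. complex_of_real (f b) * complex_of_real (sin ((s *\<^sub>R b) \<bullet> x)))"
    by (intro trig_poly_sum trig_poly_mult trig_poly_const trig_poly_sin_inner)
  moreover have "complex_of_real (f (sin_vec s x)) =
      (\<Sum>b\<in>Basis. complex_of_real (f b) * complex_of_real (sin ((s *\<^sub>R b) \<bullet> x)))" for x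
    by (simp add: sin_vec_def sum scaleR inner_commute mult.commute)
  ultimately show ?case by simp
qed (auto intro: trig_poly_const trig_poly.add trig_poly_mult)

text \<open>
  On the cube, Stone-Weierstrass approximates the function \<open>F y = f (arcsin y / s)\<close> (coordinatewise)
  uniformly by a polynomial \<open>p\<close>. Pulling back along the sine substitution gives a function close to \<open>f\<close>
  wherever \<open>arcsin\<close> undoes the sine, which holds on the ball of radius \<open>K\<close>. Since the sines
  never leave the cube, the pullback also stays within \<open>\<epsilon>\<close> of a value of \<open>f\<close> at points far outside
  the ball, so the mass lying there can be controlled by tightness alone.
\<close>

lemma trig_poly_approximation:
  fixes f :: "'a::euclidean_space \<Rightarrow> real"
  assumes f: "continuous_on UNIV f" and B: "\<And>x. \<bar>f x\<bar> \<le> B" and "0 < \<epsilon>"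
  obtains g where "trig_poly (\<lambda>x. complex_of_real (g x))"
    "\<And>x. norm x \<le> K \<Longrightarrow> \<bar>f x - g x\<bar> < \<epsilon>" "\<And>x. \<bar>g x\<bar> \<le> B + \<epsilon>"
proof -
  \<comment> \<open>The scale keeps \<open>s * (x \<bullet> b)\<close> within \<open>[-pi/2, pi/2]\<close> for \<open>norm x \<le> K\<close>; adding 1 covers \<open>K = 0\<close>.\<close>
  define s where "s = pi / (2 * (\<bar>K\<bar> + 1))"
  have s: "0 < s" by (simp add: s_def)
  define F where "F y = f (\<Sum>b\<in>Basis. (arcsin (y \<bullet> b) / s) *\<^sub>R b)" for y
  have "continuous_on (cbox (- One) One) F"
    unfolding F_def
    by (rule continuous_on_compose2[OF f]) (auto intro!: continuous_intros simp: mem_box s[THEN less_imp_neq, symmetric])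
  then obtain p where p: "real_polynomial_function p"
    "\<And>y. y \<in> cbox (- One) One \<Longrightarrow> \<bar>F y - p y\<bar> < \<epsilon>"
    using Stone_Weierstrass_real_polynomial_function[OF compact_cbox _ \<open>0 < \<epsilon>\<close>] by blast
  have approx: "\<bar>F (sin_vec s x) - p (sin_vec s x)\<bar> < \<epsilon>" for x
    by (rule p(2)) (auto simp: mem_box sin_vec_inner)
  have F_eq: "F (sin_vec s x) = f x" if x: "norm x \<le> K" for x
  proof -
    have "arcsin (sin (s * (x \<bullet> b))) / s = x \<bullet> b" if b: "b \<in> Basis" for b
    proof -
      have "\<bar>x \<bullet> b\<bar> \<le> \<bar>K\<bar> + 1"
        using Basis_le_norm[OF b, of x] x by linarith
      then have "s * \<bar>x \<bullet> b\<bar> \<le> s * (\<bar>K\<bar> + 1)"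
        using s by (intro mult_left_mono) auto
      also have "\<dots> = pi / 2" unfolding s_def by (simp add: field_simps)
      finally have "\<bar>s * (x \<bullet> b)\<bar> \<le> pi / 2" using s by (simp add: abs_mult)
      then have "arcsin (sin (s * (x \<bullet> b))) = s * (x \<bullet> b)"
        by (intro arcsin_sin) auto
      then show ?thesis using s by simp
    qed
    then have "(\<Sum>b\<in>Basis. (arcsin (sin_vec s x \<bullet> b) / s) *\<^sub>R b) = (\<Sum>b\<in>Basis. (x \<bullet> b) *\<^sub>R b)"
      by (intro sum.cong) (auto simp: sin_vec_inner)
    then show ?thesis unfolding F_def by (simp add: euclidean_representation)
  qed
  show thesis
  proof (rule that)
    show "trig_poly (\<lambda>x. complex_of_real (p (sin_vec s x)))"
      by (rule trig_poly_real_polynomial_sin_vec[OF p(1)])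
    show "\<bar>f x - p (sin_vec s x)\<bar> < \<epsilon>" if "norm x \<le> K" for x
      using approx[of x] F_eq[OF that] by simp
    show "\<bar>p (sin_vec s x)\<bar> \<le> B + \<epsilon>" for x
    proof -
      have "\<bar>F (sin_vec s x)\<bar> \<le> B" unfolding F_def by (rule B)
      with approx[of x] show ?thesis by linarith
    qed
  qed
qed

lemma trig_poly_continuous: "trig_poly g \<Longrightarrow> continuous_on UNIV g"
  by (induction rule: trig_poly.induct) (auto intro!: continuous_intros)

lemma (in prob_space) integrable_trig_poly:
  assumes "trig_poly g" and [measurable]: "X \<in> borel_measurable M"
  shows "integrable M (\<lambda>\<omega>. g (X \<omega>))"
  using assms(1) by induction (auto intro!: integrable_iexp_inner)

section \<open>Levy's continuity theorem in Euclidean spaces\<close>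

lemma tendsto_integral_trig_poly:
  fixes X :: "nat \<Rightarrow> 'a \<Rightarrow> 'c::euclidean_space"
  assumes "prob_space M" "prob_space L" and [measurable]: "\<And>n. X n \<in> borel_measurable M" "X\<^sub>0 \<in> borel_measurable L"
    and char: "\<And>t. (\<lambda>n. char_vec (distr M borel (X n)) t) \<longlonglongrightarrow> char_vec (distr L borel X\<^sub>0) t"
    and "trig_poly g"
  shows "(\<lambda>n. CLINT \<omega>|M. g (X n \<omega>)) \<longlonglongrightarrow> (CLINT \<omega>|L. g (X\<^sub>0 \<omega>))"
  using \<open>trig_poly g\<close>
proof induction
  case (monom c t)
  from char[of t] show ?case by (auto simp: char_vec_distr intro!: tendsto_intros)
next
  case (add f g)
  have "integrable M (\<lambda>\<omega>. f (X n \<omega>))" "integrable M (\<lambda>\<omega>. g (X n \<omega>))" for n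
    using add.hyps by (auto intro: prob_space.integrable_trig_poly[OF \<open>prob_space M\<close>])
  moreover have "integrable L (\<lambda>\<omega>. f (X\<^sub>0 \<omega>))" "integrable L (\<lambda>\<omega>. g (X\<^sub>0 \<omega>))"
    using add.hyps by (auto intro: prob_space.integrable_trig_poly[OF \<open>prob_space L\<close>])
  ultimately show ?case
    using tendsto_add[OF add.IH] by simp
qed

text \<open>
  The characteristic function of a projection \<open>X \<bullet> b\<close> at \<open>s\<close> is that of \<open>X\<close> at \<open>s *\<^sub>R b\<close>, so Levy's theorem
  on the real line applies to every projection. Its purpose here is to supply tightness.
\<close>

lemma levy_continuity_coordinate:
  fixes X :: "nat \<Rightarrow> 'a \<Rightarrow> 'c::euclidean_space"
  assumes "prob_space M" "prob_space L" and [measurable]: "\<And>n. X n \<in> borel_measurable M" "X\<^sub>0 \<in> borel_measurable L"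
    and char: "\<And>t. (\<lambda>n. char_vec (distr M borel (X n)) t) \<longlonglongrightarrow> char_vec (distr L borel X\<^sub>0) t"
  shows "conv_in_distr M (\<lambda>n \<omega>. X n \<omega> \<bullet> b) L (\<lambda>\<omega>. X\<^sub>0 \<omega> \<bullet> b)"
  unfolding conv_in_distr_def
proof (intro allI impI)
  interpret M: prob_space M by fact
  interpret L: prob_space L by fact
  fix f :: "real \<Rightarrow> real" assume f: "continuous_on UNIV f" "bounded (range f)"
  obtain B where B: "\<And>x. norm (f x) \<le> B"
    using f(2) by (auto simp: bounded_iff)
  have [measurable]: "f \<in> borel_measurable borel"
    using f(1) by (rule borel_measurable_continuous_onI)
  let ?\<mu> = "\<lambda>n. distr M borel (\<lambda>\<omega>. X n \<omega> \<bullet> b)" and ?\<nu> = "distr L borel (\<lambda>\<omega>. X\<^sub>0 \<omega> \<bullet> b)"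
  have "(\<lambda>n. char (?\<mu> n) s) \<longlonglongrightarrow> char ?\<nu> s" for s
    using char[of "s *\<^sub>R b"]
    by (simp add: char_vec_real[symmetric] char_vec_distr inner_commute)
  then have "weak_conv_m ?\<mu> ?\<nu>"
    by (intro levy_continuity) auto
  then have "(\<lambda>n. integral\<^sup>L (?\<mu> n) f) \<longlonglongrightarrow> integral\<^sup>L ?\<nu> f"
    using f(1) B
    by (intro weak_conv_imp_integral_bdd_continuous_conv[where B=B]) (auto simp: continuous_on_eq_continuous_at)
  then show "(\<lambda>n. \<integral>\<omega>. f (X n \<omega> \<bullet> b) \<partial>M) \<longlonglongrightarrow> (\<integral>\<omega>. f (X\<^sub>0 \<omega> \<bullet> b) \<partial>L)"
    by (simp add: integral_distr)
qed

lemma (in prob_space) integral_diff_le_off_ball: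
  fixes X :: "'a \<Rightarrow> 'c::euclidean_space" and f g :: "'c \<Rightarrow> real"
  assumes [measurable]: "X \<in> borel_measurable M" "f \<in> borel_measurable borel" "g \<in> borel_measurable borel"
    and f: "\<And>x. \<bar>f x\<bar> \<le> B" and g: "\<And>x. \<bar>g x\<bar> \<le> C"
    and close: "\<And>x. norm x \<le> K \<Longrightarrow> \<bar>f x - g x\<bar> \<le> \<epsilon>" and "0 \<le> \<epsilon>"
  shows "\<bar>(\<integral>\<omega>. f (X \<omega>) \<partial>M) - (\<integral>\<omega>. g (X \<omega>) \<partial>M)\<bar> \<le> \<epsilon> + (B + C) * prob {\<omega> \<in> space M. K < norm (X \<omega>)}"
proof -
  let ?A = "{\<omega> \<in> space M. K < norm (X \<omega>)}"
  have int: "integrable M (\<lambda>\<omega>. f (X \<omega>))" "integrable M (\<lambda>\<omega>. g (X \<omega>))"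
    using integrable_const_bound[of "\<lambda>\<omega>. f (X \<omega>)" B] integrable_const_bound[of "\<lambda>\<omega>. g (X \<omega>)" C] f g
    by auto
  have intA: "integrable M (indicator ?A :: 'a \<Rightarrow> real)"
    by (simp add: integrable_indicator_iff emeasure_eq_measure)
  have "\<bar>(\<integral>\<omega>. f (X \<omega>) \<partial>M) - (\<integral>\<omega>. g (X \<omega>) \<partial>M)\<bar> = \<bar>\<integral>\<omega>. f (X \<omega>) - g (X \<omega>) \<partial>M\<bar>"
    using int by simp
  also have "\<dots> \<le> (\<integral>\<omega>. \<bar>f (X \<omega>) - g (X \<omega>)\<bar> \<partial>M)"
    by (rule integral_abs_bound)
  also have "\<dots> \<le> (\<integral>\<omega>. \<epsilon> + (B + C) * indicator ?A \<omega> \<partial>M)"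
  proof (rule integral_mono)
    show "integrable M (\<lambda>\<omega>. \<epsilon> + (B + C) * indicator ?A \<omega>)"
      using intA by (intro Bochner_Integration.integrable_add integrable_mult_right integrable_const)
    fix \<omega> assume "\<omega> \<in> space M"
    then show "\<bar>f (X \<omega>) - g (X \<omega>)\<bar> \<le> \<epsilon> + (B + C) * indicator ?A \<omega>"
      using f[of "X \<omega>"] g[of "X \<omega>"] close[of "X \<omega>"] \<open>0 \<le> \<epsilon>\<close>
      by (cases "norm (X \<omega>) \<le> K") auto
  qed (use int in auto)
  also have "\<dots> = \<epsilon> + (B + C) * prob ?A"
    using intA by (subst Bochner_Integration.integral_add) (auto simp: prob_space)
  finally show ?thesis .
qed

text \<open>
  The projections converge by the one-dimensional theorem, so the sequence is tight. Given a bounded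
  continuous \<open>f\<close>, take a trigonometric polynomial \<open>g\<close> that is close to \<open>f\<close> on a ball carrying almost all
  mass and bounded everywhere. The integrals of \<open>g\<close> converge by hypothesis, and those of \<open>f\<close> and \<open>g\<close>
  differ by little, uniformly in \<open>n\<close>.
\<close>

theorem levy_continuity_euclidean:
  fixes X :: "nat \<Rightarrow> 'a \<Rightarrow> 'c::euclidean_space"
  assumes M: "prob_space M" and L: "prob_space L"
    and X[measurable]: "\<And>n. X n \<in> borel_measurable M" "X\<^sub>0 \<in> borel_measurable L"
    and char: "\<And>t. (\<lambda>n. char_vec (distr M borel (X n)) t) \<longlonglongrightarrow> char_vec (distr L borel X\<^sub>0) t"
  shows "conv_in_distr M X L X\<^sub>0"
  unfolding conv_in_distr_def
proof (intro allI impI)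
  interpret M: prob_space M by fact
  interpret L: prob_space L by fact
  fix f :: "'c \<Rightarrow> real" assume f: "continuous_on UNIV f" "bounded (range f)"
  obtain B where B: "0 < B" "\<And>x. \<bar>f x\<bar> \<le> B"
    using f(2) by (auto simp: bounded_pos)
  have [measurable]: "f \<in> borel_measurable borel"
    using f(1) by (rule borel_measurable_continuous_onI)
  show "(\<lambda>n. \<integral>\<omega>. f (X n \<omega>) \<partial>M) \<longlonglongrightarrow> (\<integral>\<omega>. f (X\<^sub>0 \<omega>) \<partial>L)"
    unfolding tendsto_iff dist_real_def
  proof (intro allI impI)
    fix r :: real assume "0 < r"
    \<comment> \<open>Replacing \<open>f\<close> by \<open>g\<close> costs \<open>2 * \<epsilon>\<close> on each side and the convergence of \<open>g\<close> one more \<open>\<epsilon>\<close>.\<close>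
    define \<epsilon> where "\<epsilon> = min 1 (r / 5)"
    have \<epsilon>: "0 < \<epsilon>" "\<epsilon> \<le> 1" "\<epsilon> \<le> r / 5"
      using \<open>0 < r\<close> by (auto simp: \<epsilon>_def)
    define \<delta> where "\<delta> = \<epsilon> / (2 * B + 1)"
    have \<delta>: "0 < \<delta>" using \<epsilon> B by (simp add: \<delta>_def)
    obtain K1 where K1: "\<forall>\<^sub>F n in sequentially. measure M {\<omega> \<in> space M. K1 < norm (X n \<omega>)} < \<delta>"
    proof (rule tight_coordinates[OF M X(1) \<delta>])
      fix b :: 'c and \<delta> :: real assume "0 < \<delta>"
      then show "\<exists>K. \<forall>\<^sub>F n in sequentially. measure M {\<omega> \<in> space M. K < \<bar>X n \<omega> \<bullet> b\<bar>} < \<delta>"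
        by (rule_tac conv_in_distr_tight_real[OF levy_continuity_coordinate[OF M L X char, of b] M L]) auto
    qed
    \<comment> \<open>A constant sequence turns the tightness lemma into a statement about the limit alone.\<close>
    have "conv_in_distr L (\<lambda>n \<omega>. norm (X\<^sub>0 \<omega>)) L (\<lambda>\<omega>. norm (X\<^sub>0 \<omega>))"
      by (simp add: conv_in_distr_def)
    then obtain K2 where K2: "measure L {\<omega> \<in> space L. K2 < norm (X\<^sub>0 \<omega>)} < \<delta>"
      using conv_in_distr_tight_real[OF _ L L _ _ \<delta>, of "\<lambda>n \<omega>. norm (X\<^sub>0 \<omega>)" "\<lambda>\<omega>. norm (X\<^sub>0 \<omega>)"]
      by auto
    obtain g where g: "trig_poly (\<lambda>x. complex_of_real (g x))"
      "\<And>x. norm x \<le> max K1 K2 \<Longrightarrow> \<bar>f x - g x\<bar> < \<epsilon>" "\<And>x. \<bar>g x\<bar> \<le> B + \<epsilon>"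
      using trig_poly_approximation[OF f(1) B(2) \<epsilon>(1)] by blast
    have "continuous_on UNIV g"
      using continuous_on_Re[OF trig_poly_continuous[OF g(1)]] by simp
    then have [measurable]: "g \<in> borel_measurable borel"
      by (rule borel_measurable_continuous_onI)
    have mono: "\<bar>f x - g x\<bar> \<le> \<epsilon>" if "norm x \<le> K1 \<or> norm x \<le> K2" for x
    proof -
      have "norm x \<le> max K1 K2" using that by (simp add: le_max_iff_disj)
      then show ?thesis by (rule less_imp_le[OF g(2)])
    qed
    have small: "\<epsilon> + (B + (B + \<epsilon>)) * q \<le> 2 * \<epsilon>" if "q < \<delta>" "0 \<le> q" for q
    proof -
      have "(B + (B + \<epsilon>)) * q \<le> (2 * B + 1) * \<delta>"
        using that B \<epsilon> by (intro mult_mono) auto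
      also have "\<dots> = \<epsilon>" using B by (simp add: \<delta>_def)
      finally show ?thesis by simp
    qed
    have "(\<lambda>n. CLINT \<omega>|M. complex_of_real (g (X n \<omega>))) \<longlonglongrightarrow> (CLINT \<omega>|L. complex_of_real (g (X\<^sub>0 \<omega>)))"
      by (rule tendsto_integral_trig_poly[OF M L X char g(1)])
    then have "(\<lambda>n. \<integral>\<omega>. g (X n \<omega>) \<partial>M) \<longlonglongrightarrow> (\<integral>\<omega>. g (X\<^sub>0 \<omega>) \<partial>L)"
      by (simp add: tendsto_of_real_iff)
    then have "\<forall>\<^sub>F n in sequentially. \<bar>(\<integral>\<omega>. g (X n \<omega>) \<partial>M) - (\<integral>\<omega>. g (X\<^sub>0 \<omega>) \<partial>L)\<bar> < \<epsilon>"
      using \<epsilon>(1) unfolding tendsto_iff dist_real_def by blast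
    with K1 show "\<forall>\<^sub>F n in sequentially. \<bar>(\<integral>\<omega>. f (X n \<omega>) \<partial>M) - (\<integral>\<omega>. f (X\<^sub>0 \<omega>) \<partial>L)\<bar> < r"
    proof eventually_elim
      case (elim n)
      have "\<bar>(\<integral>\<omega>. f (X n \<omega>) \<partial>M) - (\<integral>\<omega>. g (X n \<omega>) \<partial>M)\<bar> \<le> 2 * \<epsilon>"
        by (rule order_trans[OF M.integral_diff_le_off_ball[OF _ _ _ B(2) g(3), where K=K1] small])
          (use elim(1) mono \<epsilon> in auto)
      moreover have "\<bar>(\<integral>\<omega>. f (X\<^sub>0 \<omega>) \<partial>L) - (\<integral>\<omega>. g (X\<^sub>0 \<omega>) \<partial>L)\<bar> \<le> 2 * \<epsilon>"
        by (rule order_trans[OF L.integral_diff_le_off_ball[OF _ _ _ B(2) g(3), where K=K2] small])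
          (use K2 mono \<epsilon> in auto)
      ultimately show ?case using elim(2) \<epsilon>(3) by linarith
    qed
  qed
qed

section \<open>Independence and random indices\<close>

lemma (in prob_space) indep_rv_compose:
  assumes ind: "indep_rv M S X T Y" and f: "f \<in> measurable S S'" and g: "g \<in> measurable T T'"
  shows "indep_rv M S' (\<lambda>\<omega>. f (X \<omega>)) T' (\<lambda>\<omega>. g (Y \<omega>))"
proof -
  have sub: "{(\<lambda>\<omega>. k (Z \<omega>)) -` A \<inter> space M |A. A \<in> sets R'} \<subseteq> {Z -` A \<inter> space M |A. A \<in> sets R}"
    if Z: "Z \<in> measurable M R" and k: "k \<in> measurable R R'" for Z R R' and k :: "'x \<Rightarrow> 'y"
  proof safe
    fix A assume "A \<in> sets R'"
    then have "k -` A \<inter> space R \<in> sets R" using k by (rule measurable_sets[rotated])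
    moreover have "(\<lambda>\<omega>. k (Z \<omega>)) -` A \<inter> space M = Z -` (k -` A \<inter> space R) \<inter> space M"
      using measurable_space[OF Z] by auto
    ultimately show "\<exists>B. (\<lambda>\<omega>. k (Z \<omega>)) -` A \<inter> space M = Z -` B \<inter> space M \<and> B \<in> sets R"
      by blast
  qed
  from ind have X: "X \<in> measurable M S" and Y: "Y \<in> measurable M T"
    and I: "indep_set {X -` A \<inter> space M |A. A \<in> sets S} {Y -` B \<inter> space M |B. B \<in> sets T}"
    by (auto simp: indep_rv_def)
  have "indep_set {(\<lambda>\<omega>. f (X \<omega>)) -` A \<inter> space M |A. A \<in> sets S'}
      {(\<lambda>\<omega>. g (Y \<omega>)) -` B \<inter> space M |B. B \<in> sets T'}"
    unfolding indep_set_def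
    by (rule indep_sets_mono_sets[OF I[unfolded indep_set_def]])
      (use sub[OF X f] sub[OF Y g] in \<open>auto split: bool.split\<close>)
  then show ?thesis
    unfolding indep_rv_def using measurable_compose[OF X f] measurable_compose[OF Y g] by blast
qed

text \<open>
  Independence makes the joint law a product, and Fubini then integrates one variable first. The product
  characterisation of independence speaks of two variables with a common value type, so
  \<open>X\<close> and \<open>Y\<close> are first embedded as \<open>(X, 0)\<close> and \<open>(0, Y)\<close> into the product space.
\<close>

lemma (in prob_space) indep_rv_integral:
  fixes X :: "'a \<Rightarrow> 'b::euclidean_space" and Y :: "'a \<Rightarrow> 'c::euclidean_space"
    and f :: "'b \<Rightarrow> 'c \<Rightarrow> complex"
  assumes ind: "indep_rv M borel X borel Y"
    and [measurable]: "case_prod f \<in> borel_measurable borel"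
    and B: "\<And>x y. cmod (f x y) \<le> B"
  shows "(CLINT \<omega>|M. f (X \<omega>) (Y \<omega>)) = (CLINT \<omega>|M. CLINT \<omega>'|M. f (X \<omega>') (Y \<omega>))"
proof -
  let ?X = "\<lambda>\<omega>. (X \<omega>, 0::'c)" and ?Y = "\<lambda>\<omega>. (0::'b, Y \<omega>)"
  have [measurable]: "X \<in> borel_measurable M" "Y \<in> borel_measurable M"
    using ind by (auto simp: indep_rv_def)
  have "indep_rv M borel ?X borel ?Y"
    by (rule indep_rv_compose[OF ind, of "\<lambda>x. (x, 0)" borel "\<lambda>y. (0, y)" borel]) auto
  then have eq: "distr M borel ?X \<Otimes>\<^sub>M distr M borel ?Y = distr M (borel \<Otimes>\<^sub>M borel) (\<lambda>\<omega>. (?X \<omega>, ?Y \<omega>))"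
    by (simp add: indep_rv_iff_indep_var indep_var_distribution_eq)
  interpret PX: prob_space "distr M borel ?X" by (rule prob_space_distr) measurable
  interpret PY: prob_space "distr M borel ?Y" by (rule prob_space_distr) measurable
  interpret P: pair_prob_space "distr M borel ?X" "distr M borel ?Y" ..
  have f[measurable]: "(\<lambda>x. f (g x) (k x)) \<in> borel_measurable R"
    if [measurable]: "g \<in> borel_measurable R" "k \<in> borel_measurable R" for R :: "'d measure" and g k
    using measurable_compose[of "\<lambda>x. (g x, k x)" R borel "case_prod f" borel] by simp
  have proj[measurable]: "fst \<in> borel_measurable (borel :: ('b \<times> 'c) measure)"
    "snd \<in> borel_measurable (borel :: ('b \<times> 'c) measure)"
    by (auto intro!: borel_measurable_continuous_onI continuous_intros)
  have F[measurable]: "(\<lambda>(p, q). f (fst p) (snd q))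
      \<in> borel_measurable ((borel :: ('b \<times> 'c) measure) \<Otimes>\<^sub>M (borel :: ('b \<times> 'c) measure))"
    unfolding case_prod_beta'
    by (rule f) (rule measurable_compose[OF measurable_fst proj(1)] measurable_compose[OF measurable_snd proj(2)])+
  have "(CLINT \<omega>|M. f (X \<omega>) (Y \<omega>))
      = (CLINT z|distr M (borel \<Otimes>\<^sub>M borel) (\<lambda>\<omega>. (?X \<omega>, ?Y \<omega>)). (\<lambda>(p, q). f (fst p) (snd q)) z)"
    by (subst integral_distr[OF _ F]) auto
  also have "\<dots> = (CLINT z|distr M borel ?X \<Otimes>\<^sub>M distr M borel ?Y. (\<lambda>(p, q). f (fst p) (snd q)) z)"
    unfolding eq ..
  also have "\<dots> = (CLINT q|distr M borel ?Y. CLINT p|distr M borel ?X. f (fst p) (snd q))"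
    by (rule P.integral_snd[symmetric])
      (rule P.integrable_const_bound[where B=B], auto simp: B F cong: measurable_cong_sets)
  also have "\<dots> = (CLINT \<omega>|M. CLINT p|distr M borel ?X. f (fst p) (snd (?Y \<omega>)))"
    by (rule integral_distr) measurable
  also have "\<dots> = (CLINT \<omega>|M. CLINT \<omega>'|M. f (X \<omega>') (Y \<omega>))"
    by (subst integral_distr) auto
  finally show ?thesis .
qed

text \<open>
  Conditionally on \<open>(U, V)\<close>, the vector \<open>U *\<^sub>R Y + V\<close> is an affine image of \<open>Y\<close>. This expresses the limit law
  through the same functional of \<open>(U, V)\<close> that appears along the sequence.
\<close>

lemma char_vec_affine_indep:
  fixes Y V :: "'a \<Rightarrow> 'b::euclidean_space" and U :: "'a \<Rightarrow> real"
  assumes "prob_space L" and ind: "indep_rv L borel Y borel (\<lambda>\<omega>. (U \<omega>, V \<omega>))"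
    and [measurable]: "U \<in> borel_measurable L" "V \<in> borel_measurable L"
  shows "char_vec (distr L borel (\<lambda>\<omega>. U \<omega> *\<^sub>R Y \<omega> + V \<omega>)) t
    = (CLINT \<omega>|L. char_vec (distr L borel Y) (U \<omega> *\<^sub>R t) * iexp (t \<bullet> V \<omega>))"
proof -
  interpret prob_space L by fact
  have [measurable]: "Y \<in> borel_measurable L" using ind by (auto simp: indep_rv_def)
  let ?f = "\<lambda>(y::'b) (w::real \<times> 'b). iexp ((fst w *\<^sub>R t) \<bullet> y) * iexp (t \<bullet> snd w)"
  have "char_vec (distr L borel (\<lambda>\<omega>. U \<omega> *\<^sub>R Y \<omega> + V \<omega>)) t = (CLINT \<omega>|L. ?f (Y \<omega>) (U \<omega>, V \<omega>))"
    by (simp add: char_vec_distr inner_add_right exp_add[symmetric] distrib_left)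
  also have "\<dots> = (CLINT \<omega>|L. CLINT \<omega>'|L. ?f (Y \<omega>') (U \<omega>, V \<omega>))"
    by (rule indep_rv_integral[OF ind, where B=1])
      (auto simp: norm_mult case_prod_beta' intro!: borel_measurable_continuous_onI continuous_intros)
  also have "\<dots> = (CLINT \<omega>|L. char_vec (distr L borel Y) (U \<omega> *\<^sub>R t) * iexp (t \<bullet> V \<omega>))"
    by (simp add: char_vec_distr)
  finally show ?thesis .
qed

lemma (in prob_space) measurable_random_index:
  assumes N: "N \<in> measurable M (count_space UNIV)" and I: "\<And>\<omega>. \<omega> \<in> space M \<Longrightarrow> N \<omega> \<in> I" "countable I"
    and X: "\<And>k. k \<in> I \<Longrightarrow> X k \<in> measurable M R"
  shows "(\<lambda>\<omega>. X (N \<omega>) \<omega>) \<in> measurable M R"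
proof (rule measurable_compose_countable'[OF X _ I(2)])
  show "N \<in> measurable M (count_space I)"
    using I measurable_sets[OF N] by (auto simp: measurable_count_space_eq_countable)
qed

text \<open>
  Conditioning on \<open>N\<close> without conditional expectations: on each event \<open>N = k\<close> the index is constant, and
  independence of \<open>N\<close> from the single vector \<open>X k\<close> factorises the integral. Summation over the countably
  many \<open>k\<close> gives the claim.
\<close>

lemma (in prob_space) expectation_random_index:
  fixes N :: "'a \<Rightarrow> nat" and X :: "nat \<Rightarrow> 'a \<Rightarrow> 'b::euclidean_space" and \<phi> :: "nat \<Rightarrow> 'b \<Rightarrow> complex"
  assumes N[measurable]: "N \<in> measurable M (count_space UNIV)"
    and I: "\<And>\<omega>. \<omega> \<in> space M \<Longrightarrow> N \<omega> \<in> I"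
    and ind: "\<And>k. k \<in> I \<Longrightarrow> indep_rv M (count_space UNIV) N borel (X k)"
    and \<phi>[measurable]: "\<And>k. \<phi> k \<in> borel_measurable borel" and B: "\<And>k x. cmod (\<phi> k x) \<le> B"
  shows "(CLINT \<omega>|M. \<phi> (N \<omega>) (X (N \<omega>) \<omega>)) = (CLINT \<omega>|M. (CLINT \<omega>'|M. \<phi> (N \<omega>) (X (N \<omega>) \<omega>')))"
proof -
  define G where "G k = (CLINT \<omega>|M. \<phi> k (X k \<omega>))" for k
  define A where "A k = {\<omega> \<in> space M. N \<omega> = k}" for k
  have A[measurable]: "A k \<in> sets M" for k unfolding A_def by measurable
  have disj: "A i \<inter> A j = {}" if "i \<noteq> j" for i j using that by (auto simp: A_def)
  have UN: "(\<Union>k. A k) = space M" by (auto simp: A_def)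
  have X: "X k \<in> borel_measurable M" if "k \<in> I" for k
    using ind[OF that] by (simp add: indep_rv_def)
  have "0 \<le> B" using B[of 0 0] norm_ge_zero order_trans by blast
  have split: "(CLINT \<omega>|M. f \<omega>) = (\<Sum>k. CLINT \<omega>:A k|M. f \<omega>)"
    if [measurable]: "f \<in> borel_measurable M" and f: "\<And>\<omega>. cmod (f \<omega>) \<le> B" for f
  proof -
    have int: "integrable M f" by (rule integrable_const_bound[where B=B]) (auto simp: f)
    then have "set_integrable M (\<Union>k. A k) f"
      unfolding UN set_integrable_def by (intro integrable_mult_indicator) auto
    from lebesgue_integral_countable_add[OF A disj this] show ?thesis
      unfolding UN by (simp add: set_integral_space[OF int])
  qed
  have on_event: "(CLINT \<omega>:A k|M. \<phi> (N \<omega>) (X (N \<omega>) \<omega>)) = (CLINT \<omega>:A k|M. G (N \<omega>))" for k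
  proof (cases "k \<in> I")
    case True
    note [measurable] = X[OF True]
    let ?\<chi> = "\<lambda>j. complex_of_real (indicator {k} j)"
    have "indep_rv M borel (\<lambda>\<omega>. ?\<chi> (N \<omega>)) borel (\<lambda>\<omega>. \<phi> k (X k \<omega>))"
      by (rule indep_rv_compose[OF ind[OF True]]) auto
    then have indep: "indep_var borel (\<lambda>\<omega>. ?\<chi> (N \<omega>)) borel (\<lambda>\<omega>. \<phi> k (X k \<omega>))"
      by (simp add: indep_rv_iff_indep_var)
    have int: "integrable M (\<lambda>\<omega>. ?\<chi> (N \<omega>))" "integrable M (\<lambda>\<omega>. \<phi> k (X k \<omega>))"
      by (auto intro!: integrable_const_bound[where B="max 1 B"] simp: indicator_def B le_max_iff_disj)
    have "(CLINT \<omega>:A k|M. \<phi> (N \<omega>) (X (N \<omega>) \<omega>)) = (CLINT \<omega>|M. ?\<chi> (N \<omega>) * \<phi> k (X k \<omega>))"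
      unfolding set_lebesgue_integral_def
      by (rule Bochner_Integration.integral_cong) (auto simp: A_def indicator_def)
    also have "\<dots> = (CLINT \<omega>|M. ?\<chi> (N \<omega>)) * G k"
      unfolding G_def by (rule indep_var_lebesgue_integral[OF indep int])
    also have "\<dots> = (CLINT \<omega>|M. ?\<chi> (N \<omega>) * G k)"
      by simp
    also have "\<dots> = (CLINT \<omega>:A k|M. G (N \<omega>))"
      unfolding set_lebesgue_integral_def
      by (rule Bochner_Integration.integral_cong) (auto simp: A_def indicator_def)
    finally show ?thesis .
  next
    case False
    then have "A k = {}" using I by (auto simp: A_def)
    then show ?thesis by (simp add: set_lebesgue_integral_def)
  qed
  have "(\<lambda>\<omega>. \<phi> (N \<omega>) (X (N \<omega>) \<omega>)) \<in> borel_measurable M"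
    by (rule measurable_random_index[OF N I, where X="\<lambda>k \<omega>. \<phi> k (X k \<omega>)"])
      (auto intro: measurable_compose[OF X \<phi>])
  then have "(CLINT \<omega>|M. \<phi> (N \<omega>) (X (N \<omega>) \<omega>)) = (\<Sum>k. CLINT \<omega>:A k|M. \<phi> (N \<omega>) (X (N \<omega>) \<omega>))"
    by (rule split) (rule B)
  also have "\<dots> = (\<Sum>k. CLINT \<omega>:A k|M. G (N \<omega>))"
    by (simp only: on_event)
  also have "\<dots> = (CLINT \<omega>|M. G (N \<omega>))"
  proof (rule split[symmetric])
    show "(\<lambda>\<omega>. G (N \<omega>)) \<in> borel_measurable M"
      by (rule measurable_compose[OF N]) simp
    show "cmod (G (N \<omega>)) \<le> B" for \<omega>
      unfolding G_def by (rule cmod_integral_le) (auto simp: B \<open>0 \<le> B\<close>)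
  qed
  finally show ?thesis unfolding G_def .
qed

text \<open>
  This is where a coherency condition, uniform only on balls, meets a random argument \<open>U *\<^sub>R t\<close>. If
  \<open>\<bar>U\<bar> \<le> K\<close>, the argument lies in the ball of radius \<open>T\<close> and the supremum bounds the difference; otherwise
  the trivial bound 2 for a difference of two characteristic functions is used.
\<close>

lemma (in prob_space) random_char_substitution_error:
  fixes \<Phi> :: "'a \<Rightarrow> 'c::euclidean_space \<Rightarrow> complex" and h :: "'c \<Rightarrow> complex" and U :: "'a \<Rightarrow> real"
    and e :: "'a \<Rightarrow> complex"
  assumes bd: "\<And>\<omega> s. \<omega> \<in> space M \<Longrightarrow> cmod (\<Phi> \<omega> s) \<le> 1" "\<And>s. cmod (h s) \<le> 1" "\<And>\<omega>. cmod (e \<omega>) \<le> 1"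
    and [measurable]: "U \<in> borel_measurable M" "e \<in> borel_measurable M"
      "(\<lambda>\<omega>. \<Phi> \<omega> (U \<omega> *\<^sub>R t)) \<in> borel_measurable M" "(\<lambda>\<omega>. h (U \<omega> *\<^sub>R t)) \<in> borel_measurable M"
      "(\<lambda>\<omega>. SUP s\<in>{s. norm s \<le> T}. cmod (\<Phi> \<omega> s - h s)) \<in> borel_measurable M"
    and T: "0 \<le> T" "K * norm t \<le> T"
  shows "cmod ((CLINT \<omega>|M. \<Phi> \<omega> (U \<omega> *\<^sub>R t) * e \<omega>) - (CLINT \<omega>|M. h (U \<omega> *\<^sub>R t) * e \<omega>))
    \<le> (\<integral>\<omega>. (SUP s\<in>{s. norm s \<le> T}. cmod (\<Phi> \<omega> s - h s)) \<partial>M) + 2 * prob {\<omega> \<in> space M. K < \<bar>U \<omega>\<bar>}"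
proof -
  let ?S = "\<lambda>\<omega>. SUP s\<in>{s. norm s \<le> T}. cmod (\<Phi> \<omega> s - h s)"
  let ?A = "{\<omega> \<in> space M. K < \<bar>U \<omega>\<bar>}"
  have diff: "cmod (\<Phi> \<omega> s - h s) \<le> 2" if "\<omega> \<in> space M" for \<omega> s
    using norm_triangle_ineq4[of "\<Phi> \<omega> s" "h s"] bd(1)[OF that, of s] bd(2)[of s] by linarith
  have le_S: "cmod (\<Phi> \<omega> s - h s) \<le> ?S \<omega>" if "\<omega> \<in> space M" "norm s \<le> T" for \<omega> s
    using that diff by (intro cSUP_upper bdd_aboveI2[where M=2]) auto
  have S0: "0 \<le> ?S \<omega>" if "\<omega> \<in> space M" for \<omega>
    by (rule order_trans[OF norm_ge_zero le_S[OF that, of 0]]) (simp add: T(1))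
  have S2: "?S \<omega> \<le> 2" if "\<omega> \<in> space M" for \<omega>
    using diff[OF that] T(1) by (intro cSUP_least) (auto intro: exI[of _ 0])
  have prod_le: "cmod (z * e \<omega>) \<le> cmod z" for z \<omega>
    using mult_left_mono[OF bd(3)[of \<omega>] norm_ge_zero[of z]] by (simp add: norm_mult)
  have int: "integrable M (\<lambda>\<omega>. \<Phi> \<omega> (U \<omega> *\<^sub>R t) * e \<omega>)" "integrable M (\<lambda>\<omega>. h (U \<omega> *\<^sub>R t) * e \<omega>)"
    by (auto intro!: integrable_const_bound[where B=1] AE_I2 order_trans[OF prod_le] bd)
  have intS: "integrable M ?S"
    by (rule integrable_const_bound[where B=2]) (auto simp: S0 S2 intro!: AE_I2)
  have intA: "integrable M (indicator ?A :: 'a \<Rightarrow> real)"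
    by (simp add: integrable_indicator_iff emeasure_eq_measure)
  have "cmod ((CLINT \<omega>|M. \<Phi> \<omega> (U \<omega> *\<^sub>R t) * e \<omega>) - (CLINT \<omega>|M. h (U \<omega> *\<^sub>R t) * e \<omega>))
      = cmod (CLINT \<omega>|M. (\<Phi> \<omega> (U \<omega> *\<^sub>R t) - h (U \<omega> *\<^sub>R t)) * e \<omega>)"
    using int by (simp add: left_diff_distrib)
  also have "\<dots> \<le> (\<integral>\<omega>. cmod ((\<Phi> \<omega> (U \<omega> *\<^sub>R t) - h (U \<omega> *\<^sub>R t)) * e \<omega>) \<partial>M)"
    by (rule integral_norm_bound)
  also have "\<dots> \<le> (\<integral>\<omega>. ?S \<omega> + 2 * indicator ?A \<omega> \<partial>M)"
  proof (rule integral_mono)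
    show "integrable M (\<lambda>\<omega>. cmod ((\<Phi> \<omega> (U \<omega> *\<^sub>R t) - h (U \<omega> *\<^sub>R t)) * e \<omega>))"
      using int by (auto simp: left_diff_distrib)
    show "integrable M (\<lambda>\<omega>. ?S \<omega> + 2 * indicator ?A \<omega>)"
      using intS intA by (intro Bochner_Integration.integrable_add integrable_mult_right)
    fix \<omega> assume \<omega>: "\<omega> \<in> space M"
    have "cmod (\<Phi> \<omega> (U \<omega> *\<^sub>R t) - h (U \<omega> *\<^sub>R t)) \<le> ?S \<omega> + 2 * indicator ?A \<omega>"
    proof (cases "K < \<bar>U \<omega>\<bar>")
      case True
      then show ?thesis using diff[OF \<omega>, of "U \<omega> *\<^sub>R t"] S0[OF \<omega>] \<omega> by simp
    next
      case False
      then have "\<bar>U \<omega>\<bar> * norm t \<le> T"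
        using mult_right_mono[of "\<bar>U \<omega>\<bar>" K "norm t"] T(2) by simp
      then show ?thesis using le_S[OF \<omega>, of "U \<omega> *\<^sub>R t"] False by simp
    qed
    then show "cmod ((\<Phi> \<omega> (U \<omega> *\<^sub>R t) - h (U \<omega> *\<^sub>R t)) * e \<omega>) \<le> ?S \<omega> + 2 * indicator ?A \<omega>"
      using prod_le order_trans by blast
  qed
  also have "\<dots> = (\<integral>\<omega>. ?S \<omega> \<partial>M) + 2 * prob ?A"
    using intS intA by (subst Bochner_Integration.integral_add) auto
  finally show ?thesis .
qed

section \<open>Transfer of the limit to randomly indexed vectors\<close>

theorem theorem1:
  fixes M :: "'a measure" and L :: "'b measure"
    and S :: "nat \<Rightarrow> nat \<Rightarrow> 'a \<Rightarrow> real ^ 'm"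
    and a :: "nat \<Rightarrow> nat \<Rightarrow> real ^ 'm" and b :: "nat \<Rightarrow> nat \<Rightarrow> real"
    and N :: "nat \<Rightarrow> 'a \<Rightarrow> nat"
    and c :: "nat \<Rightarrow> real ^ 'm" and d :: "nat \<Rightarrow> real"
    and hnk :: "nat \<Rightarrow> nat \<Rightarrow> real ^ 'm \<Rightarrow> complex" and h :: "real ^ 'm \<Rightarrow> complex"
    and Zs :: "nat \<Rightarrow> 'a \<Rightarrow> real ^ 'm" and Us :: "nat \<Rightarrow> 'a \<Rightarrow> real" and Vs :: "nat \<Rightarrow> 'a \<Rightarrow> real ^ 'm"
    and Y V Z :: "'b \<Rightarrow> real ^ 'm" and U :: "'b \<Rightarrow> real"
  assumes "prob_space M" and "prob_space L"
    and S_rv: "\<And>n k. n \<ge> 1 \<Longrightarrow> k \<ge> 1 \<Longrightarrow> S n k \<in> borel_measurable M"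
    and b_pos: "\<And>n k. n \<ge> 1 \<Longrightarrow> k \<ge> 1 \<Longrightarrow> b n k > 0"
    and N_rv: "\<And>n. n \<ge> 1 \<Longrightarrow> N n \<in> measurable M (count_space UNIV)"
    and N_pos: "\<And>n \<omega>. n \<ge> 1 \<Longrightarrow> \<omega> \<in> space M \<Longrightarrow> N n \<omega> \<ge> 1"
    and indep_N_S: "\<And>n k. n \<ge> 1 \<Longrightarrow> k \<ge> 1 \<Longrightarrow> indep_rv M (count_space UNIV) (N n) borel (S n k)"
    and d_pos: "\<And>n. n \<ge> 1 \<Longrightarrow> d n > 0"
    and hnk: "\<And>n k. hnk n k = char_vec (distr M borel (\<lambda>\<omega>. (S n k \<omega> - a n k) /\<^sub>R b n k))"
    and Zs: "\<And>n \<omega>. Zs n \<omega> = (S n (N n \<omega>) \<omega> - c n) /\<^sub>R d n"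
    and Us: "\<And>n \<omega>. Us n \<omega> = b n (N n \<omega>) / d n"
    and Vs: "\<And>n \<omega>. Vs n \<omega> = (a n (N n \<omega>) - c n) /\<^sub>R d n"
    and Y_rv: "Y \<in> borel_measurable L"
    and h: "h = char_vec (distr L borel Y)"
    and coherency: "\<And>T. T > 0 \<Longrightarrow>
      (\<lambda>n. \<integral>\<omega>. (SUP t\<in>{t. norm t \<le> T}. cmod (hnk n (N n \<omega>) t - h t)) \<partial>M) \<longlonglongrightarrow> 0"
    and U_rv: "U \<in> borel_measurable L" and V_rv: "V \<in> borel_measurable L"
    and W_conv: "conv_in_distr M (\<lambda>n \<omega>. (Us n \<omega>, Vs n \<omega>)) L (\<lambda>\<omega>. (U \<omega>, V \<omega>))"
    and indep_Y_W: "indep_rv L borel Y borel (\<lambda>\<omega>. (U \<omega>, V \<omega>))"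
    and Z_rv: "Z \<in> borel_measurable L"
    and Z_law: "distr L borel Z = distr L borel (\<lambda>\<omega>. U \<omega> *\<^sub>R Y \<omega> + V \<omega>)"
  shows "conv_in_distr M Zs L Z"
proof -
  interpret M: prob_space M by fact
  interpret L: prob_space L by fact
  note [measurable] = Y_rv U_rv V_rv Z_rv
  have N_fun: "(\<lambda>\<omega>. F (N (Suc n) \<omega>)) \<in> borel_measurable M"
    for F :: "nat \<Rightarrow> 'x::topological_space" and n
    by (rule measurable_compose[OF N_rv]) auto
  have U_meas[measurable]: "Us (Suc n) \<in> borel_measurable M" for n
    using N_fun[of "\<lambda>k. b (Suc n) k / d (Suc n)" n] by (simp add: Us[abs_def])
  have V_meas[measurable]: "Vs (Suc n) \<in> borel_measurable M" for n
    using N_fun[of "\<lambda>k. (a (Suc n) k - c (Suc n)) /\<^sub>R d (Suc n)" n] by (simp add: Vs[abs_def])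
  have Z_meas[measurable]: "Zs (Suc n) \<in> borel_measurable M" for n
  proof -
    have "(\<lambda>\<omega>. S (Suc n) (N (Suc n) \<omega>) \<omega>) \<in> borel_measurable M"
      by (rule M.measurable_random_index[OF N_rv, where I="{1..}"])
        (use N_pos[of "Suc n"] S_rv[of "Suc n"] in auto)
    then show ?thesis unfolding Zs[abs_def] by measurable
  qed
  have Y_nk: "(\<lambda>\<omega>. (S (Suc n) k \<omega> - a (Suc n) k) /\<^sub>R b (Suc n) k) \<in> borel_measurable M" if "1 \<le> k" for n k
    using S_rv[of "Suc n" k] that by simp
  have hnk_le: "cmod (hnk (Suc n) k t) \<le> 1" if "1 \<le> k" for n k t
    unfolding hnk by (rule cmod_char_vec_distr_le_1[OF \<open>prob_space M\<close> Y_nk[OF that]])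
  have h_le: "cmod (h t) \<le> 1" for t
    unfolding h by (rule cmod_char_vec_distr_le_1[OF \<open>prob_space L\<close> Y_rv])
  have h_cont: "continuous_on UNIV h"
    unfolding h by (rule continuous_char_vec_distr[OF \<open>prob_space L\<close> Y_rv])
  then have [measurable]: "h \<in> borel_measurable borel"
    by (rule borel_measurable_continuous_onI)
  have W_conv': "conv_in_distr M (\<lambda>n \<omega>. (Us (Suc n) \<omega>, Vs (Suc n) \<omega>)) L (\<lambda>\<omega>. (U \<omega>, V \<omega>))"
    using W_conv by (simp add: conv_in_distr_Suc_iff[of M "\<lambda>n \<omega>. (Us n \<omega>, Vs n \<omega>)"])
  have U_conv: "conv_in_distr M (\<lambda>n. Us (Suc n)) L U"
    using conv_in_distr_continuous_image[OF W_conv' continuous_on_fst[OF continuous_on_id]] by simp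

  \<comment> \<open>Averaging over the index, with \<open>Zs = Us *\<^sub>R Y_nk + Vs\<close> for the normalised vector \<open>Y_nk\<close> at \<open>k = N_n\<close>.\<close>
  have char_Zs: "char_vec (distr M borel (Zs (Suc n))) t
      = (CLINT \<omega>|M. hnk (Suc n) (N (Suc n) \<omega>) (Us (Suc n) \<omega> *\<^sub>R t) * iexp (t \<bullet> Vs (Suc n) \<omega>))" for n t
  proof -
    let ?n = "Suc n"
    have "char_vec (distr M borel (Zs ?n)) t
        = (CLINT \<omega>|M. iexp (t \<bullet> ((S ?n (N ?n \<omega>) \<omega> - c ?n) /\<^sub>R d ?n)))"
      by (simp add: char_vec_distr Zs)
    also have "\<dots> = (CLINT \<omega>|M. CLINT \<omega>'|M. iexp (t \<bullet> ((S ?n (N ?n \<omega>) \<omega>' - c ?n) /\<^sub>R d ?n)))"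
      by (rule M.expectation_random_index[OF N_rv, where I="{1..}" and B=1
            and \<phi>="\<lambda>k x. iexp (t \<bullet> ((x - c ?n) /\<^sub>R d ?n))"])
        (use N_pos[of "Suc n"] indep_N_S[of "Suc n"] in auto)
    also have "\<dots> = (CLINT \<omega>|M. hnk ?n (N ?n \<omega>) (Us ?n \<omega> *\<^sub>R t) * iexp (t \<bullet> Vs ?n \<omega>))"
    proof (rule Bochner_Integration.integral_cong[OF refl])
      fix \<omega> assume "\<omega> \<in> space M"
      then have k: "1 \<le> N ?n \<omega>" using N_pos[of "Suc n"] by simp
      let ?k = "N ?n \<omega>"
      have pos: "0 < b ?n ?k" "0 < d ?n" using b_pos[OF _ k] d_pos by auto
      have "t \<bullet> ((x - c ?n) /\<^sub>R d ?n)
          = (Us ?n \<omega> *\<^sub>R t) \<bullet> ((x - a ?n ?k) /\<^sub>R b ?n ?k) + t \<bullet> Vs ?n \<omega>" for x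
        using pos by (simp add: Us Vs inner_diff_right field_simps)
      then have "iexp (t \<bullet> ((x - c ?n) /\<^sub>R d ?n))
          = iexp ((Us ?n \<omega> *\<^sub>R t) \<bullet> ((x - a ?n ?k) /\<^sub>R b ?n ?k)) * iexp (t \<bullet> Vs ?n \<omega>)" for x
        by (simp only: of_real_add distrib_left exp_add)
      then show "(CLINT \<omega>'|M. iexp (t \<bullet> ((S ?n ?k \<omega>' - c ?n) /\<^sub>R d ?n)))
          = hnk ?n ?k (Us ?n \<omega> *\<^sub>R t) * iexp (t \<bullet> Vs ?n \<omega>)"
        unfolding hnk char_vec_distr[OF Y_nk[OF k]]
        by (simp only: integral_mult_left_zero)
    qed
    finally show ?thesis .
  qed

  \<comment> \<open>With \<open>h\<close> in place of the random characteristic function, the integrand is a fixed bounded continuous function of \<open>(Us, Vs)\<close>.\<close>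
  have lim_h: "(\<lambda>n. CLINT \<omega>|M. h (Us (Suc n) \<omega> *\<^sub>R t) * iexp (t \<bullet> Vs (Suc n) \<omega>))
      \<longlonglongrightarrow> char_vec (distr L borel Z) t" for t
  proof -
    let ?f = "\<lambda>w :: real \<times> (real ^ 'm). h (fst w *\<^sub>R t) * iexp (t \<bullet> snd w)"
    have "(\<lambda>n. CLINT \<omega>|M. ?f (Us (Suc n) \<omega>, Vs (Suc n) \<omega>)) \<longlonglongrightarrow> (CLINT \<omega>|L. ?f (U \<omega>, V \<omega>))"
    proof (rule conv_in_distr_complex[OF W_conv' \<open>prob_space M\<close> \<open>prob_space L\<close>, where B=1])
      show "continuous_on UNIV ?f"
        by (intro continuous_intros continuous_on_compose2[OF h_cont]) auto
      show "cmod (?f w) \<le> 1" for w by (simp add: norm_mult h_le)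
    qed measurable
    then show ?thesis
      unfolding Z_law char_vec_affine_indep[OF \<open>prob_space L\<close> indep_Y_W U_rv V_rv] h by simp
  qed

  \<comment> \<open>Coherency pays for exchanging the two, once tightness of \<open>Us\<close> confines the argument to a ball.\<close>
  have lim_diff: "(\<lambda>n. (CLINT \<omega>|M. hnk (Suc n) (N (Suc n) \<omega>) (Us (Suc n) \<omega> *\<^sub>R t) * iexp (t \<bullet> Vs (Suc n) \<omega>))
      - (CLINT \<omega>|M. h (Us (Suc n) \<omega> *\<^sub>R t) * iexp (t \<bullet> Vs (Suc n) \<omega>))) \<longlonglongrightarrow> 0" for t
    unfolding tendsto_iff dist_0_norm dist_norm diff_zero
  proof (intro allI impI)
    fix r :: real assume "0 < r"
    then obtain K where K: "\<forall>\<^sub>F n in sequentially. measure M {\<omega> \<in> space M. K < \<bar>Us (Suc n) \<omega>\<bar>} < r / 4"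
      using conv_in_distr_tight_real[OF U_conv \<open>prob_space M\<close> \<open>prob_space L\<close> U_meas U_rv, of "r / 4"] by auto
    \<comment> \<open>Coherency is only given for positive radii, hence the absolute value and the added 1.\<close>
    define T where "T = \<bar>K\<bar> * norm t + 1"
    have "K * norm t \<le> \<bar>K\<bar> * norm t" by (rule mult_right_mono) auto
    moreover have "0 \<le> \<bar>K\<bar> * norm t" by simp
    ultimately have T: "0 < T" "K * norm t \<le> T"
      unfolding T_def by linarith+
    let ?sup = "\<lambda>n. \<integral>\<omega>. (SUP s\<in>{s. norm s \<le> T}. cmod (hnk n (N n \<omega>) s - h s)) \<partial>M"
    have "(\<lambda>n. ?sup (Suc n)) \<longlonglongrightarrow> 0"
      by (rule LIMSEQ_Suc[OF coherency[OF T(1)]])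
    then have "\<forall>\<^sub>F n in sequentially. ?sup (Suc n) < r / 2"
      using \<open>0 < r\<close> by (intro order_tendstoD) auto
    with K show "\<forall>\<^sub>F n in sequentially.
      cmod ((CLINT \<omega>|M. hnk (Suc n) (N (Suc n) \<omega>) (Us (Suc n) \<omega> *\<^sub>R t) * iexp (t \<bullet> Vs (Suc n) \<omega>))
        - (CLINT \<omega>|M. h (Us (Suc n) \<omega> *\<^sub>R t) * iexp (t \<bullet> Vs (Suc n) \<omega>))) < r"
    proof eventually_elim
      case (elim n)
      have "cmod ((CLINT \<omega>|M. hnk (Suc n) (N (Suc n) \<omega>) (Us (Suc n) \<omega> *\<^sub>R t) * iexp (t \<bullet> Vs (Suc n) \<omega>))
          - (CLINT \<omega>|M. h (Us (Suc n) \<omega> *\<^sub>R t) * iexp (t \<bullet> Vs (Suc n) \<omega>)))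
        \<le> ?sup (Suc n) + 2 * measure M {\<omega> \<in> space M. K < \<bar>Us (Suc n) \<omega>\<bar>}"
      proof (rule M.random_char_substitution_error)
        show "(\<lambda>\<omega>. hnk (Suc n) (N (Suc n) \<omega>) (Us (Suc n) \<omega> *\<^sub>R t)) \<in> borel_measurable M"
          unfolding Us by (rule N_fun)
        show "(\<lambda>\<omega>. SUP s\<in>{s. norm s \<le> T}. cmod (hnk (Suc n) (N (Suc n) \<omega>) s - h s)) \<in> borel_measurable M"
          by (rule N_fun)
      qed (use T N_pos[of "Suc n"] hnk_le in \<open>auto simp: h_le\<close>)
      then show ?case using elim by linarith
    qed
  qed

  have "(\<lambda>n. char_vec (distr M borel (Zs (Suc n))) t) \<longlonglongrightarrow> char_vec (distr L borel Z) t" for t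
    using tendsto_add[OF lim_diff[of t] lim_h[of t]] by (simp add: char_Zs)
  then have "conv_in_distr M (\<lambda>n. Zs (Suc n)) L Z"
    by (intro levy_continuity_euclidean \<open>prob_space M\<close> \<open>prob_space L\<close> Z_meas Z_rv)
  then show ?thesis by (simp add: conv_in_distr_Suc_iff)
qed

end
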